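(* Let $a<\tau<b$ be real numbers and let $f:[a,b]\to\mathbb{C}$ be in $L^1([a,b])$. Define $g(x):=f(x+\tau)$ for $x\in[a-\tau,b-\tau]$, put $r:=\min(\tau-a,\,b-\tau)>0$, and let $g_o(t):=\tfrac12\bigl(g(t)-g(-t)\bigr)$ for $t\in[-r,r]$. Assume that: (a) $t\mapsto g_o(t)/t$ belongs to $L^1([-r,r])$; (b) $f$ is continuous at $\tau$; (c) $\{z_n\}_{n\in\mathbb{N}}$ is a sequence of complex numbers contained either in $\mathcal{D}^+$ or in $\mathcal{D}^-$, where $\mathcal{D}^+=\{z\in\mathbb{C}:\operatorname{Im} z>0\}$ and $\mathcal{D}^-=\{z\in\mathbb{C}:\operatorname{Im} z<0\}$; (d) $\{z_n\}_{n\in\mathbb{N}}$ converges non-tangentially to $\tau$. For $z\in\mathbb{C}\setminus[a,b]$ let $$\Phi(z)=\frac{1}{2\pi i}\int_a^b\frac{f(t)}{t-z}\,dt.$$ Then $$\lim_{\substack{z_n\to\tau\\ z_n\in\mathcal{D}^{\pm}}}\Phi(z_n)=\pm\frac12 f(\tau)+\frac{1}{2\pi i}\,\mathrm{P.V.}\int_a^b\frac{f(t)}{t-\tau}\,dt,$$ where the sign is $+$ if the sequence is contained in $\mathcal{D}^+$ and $-$ if it is contained in $\mathcal{D}^-$.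
   Context: Principal value: for $\tau\in(a,b)$, $$\mathrm{P.V.}\int_a^b\frac{f(t)}{t-\tau}\,dt:=\lim_{\delta\to0^+}\left(\int_a^{\tau-\delta}\frac{f(t)}{t-\tau}\,dt+\int_{\tau+\delta}^b\frac{f(t)}{t-\tau}\,dt\right)$$ when the limit exists. Non-tangential convergence: with $\arg$ taking values in $[0,2\pi)$, a sequence $\{z_n\}$ in the open upper half plane converges non-tangentially to $\tau\in\mathbb{R}$ if $z_n\to\tau$ and there exists $\epsilon>0$ such that $\arg(z_n-\tau)\in(\epsilon,\pi-\epsilon)$ for all $n$. A sequence in the open lower half plane converges non-tangentially to $\tau$ if $z_n\to\tau$ and there exists $\epsilon>0$ such that $\arg(z_n-\tau)\in(\pi+\epsilon,2\pi-\epsilon)$ for all $n$. *)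

theory Defs
  imports "HOL-Analysis.Analysis"
begin

definition upper_half_plane :: "complex set" where
  "upper_half_plane = {z. Im z > 0}"

definition lower_half_plane :: "complex set" where
  "lower_half_plane = {z. Im z < 0}"

definition cauchy_integral :: "(real \<Rightarrow> complex) \<Rightarrow> real \<Rightarrow> real \<Rightarrow> complex \<Rightarrow> complex" where
  "cauchy_integral f a b z =
     1 / (2 * of_real pi * \<i>) * (LINT t:{a..b}|lebesgue. f t / (of_real t - z))"

definition truncated_pv_integral ::
  "(real \<Rightarrow> complex) \<Rightarrow> real \<Rightarrow> real \<Rightarrow> real \<Rightarrow> real \<Rightarrow> complex" where
  "truncated_pv_integral f a b \<tau> \<delta> =
     (LINT t:{a..\<tau> - \<delta>}|lebesgue. f t / of_real (t - \<tau>)) +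
     (LINT t:{\<tau> + \<delta>..b}|lebesgue. f t / of_real (t - \<tau>))"

(* The Lebesgue integral of a non-integrable function is 0 by convention, so the existence
   of the truncated integrals is required separately from the existence of their limit. *)
definition pv_exists :: "(real \<Rightarrow> complex) \<Rightarrow> real \<Rightarrow> real \<Rightarrow> real \<Rightarrow> bool" where
  "pv_exists f a b \<tau> \<longleftrightarrow>
     (\<forall>\<^sub>F \<delta> in at_right 0.
        set_integrable lebesgue {a..\<tau> - \<delta>} (\<lambda>t. f t / of_real (t - \<tau>)) \<and>
        set_integrable lebesgue {\<tau> + \<delta>..b} (\<lambda>t. f t / of_real (t - \<tau>))) \<and>
     (\<exists>L. (truncated_pv_integral f a b \<tau> \<longlongrightarrow> L) (at_right 0))"

(* The value is meaningful only under pv_exists. *)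
definition pv_integral :: "(real \<Rightarrow> complex) \<Rightarrow> real \<Rightarrow> real \<Rightarrow> real \<Rightarrow> complex" where
  "pv_integral f a b \<tau> = Lim (at_right 0) (truncated_pv_integral f a b \<tau>)"

(* Arg2pi is the argument with values in [0, 2 pi). *)
definition converges_nontangentially :: "(nat \<Rightarrow> complex) \<Rightarrow> real \<Rightarrow> bool" where
  "converges_nontangentially z \<tau> \<longleftrightarrow>
     z \<longlonglongrightarrow> of_real \<tau> \<and>
     ((\<forall>n. z n \<in> upper_half_plane) \<and>
        (\<exists>\<epsilon>>0. \<forall>n. Arg2pi (z n - of_real \<tau>) \<in> {\<epsilon><..<pi - \<epsilon>}) \<or>
      (\<forall>n. z n \<in> lower_half_plane) \<and>
        (\<exists>\<epsilon>>0. \<forall>n. Arg2pi (z n - of_real \<tau>) \<in> {pi + \<epsilon><..<2 * pi - \<epsilon>}))"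

end

theory Submission
  imports Defs
begin

text \<open>
  Move \<open>\<tau>\<close> to the origin, extend the density by zero to a function \<open>h\<close> on the line, and write
  \<open>1 / (t - w) = t / (t\<^sup>2 - w\<^sup>2) + w / (t\<^sup>2 - w\<^sup>2)\<close>, a part odd in \<open>t\<close> plus a part even in \<open>t\<close>.
  The odd part only sees \<open>h\<^sub>o(t) / t\<close>, weighted by \<open>t\<^sup>2 / (t\<^sup>2 - w\<^sup>2)\<close>, which is bounded in a
  non-tangential cone, so dominated convergence yields \<open>\<integral> h\<^sub>o(t) / t\<close>; the same symmetrization shows
  that this is the principal value. The even part is an approximate identity of mass
  \<open>\<plusminus>\<i>\<pi>\<close> and yields \<open>\<plusminus>\<i>\<pi> h(0)\<close>. The sign comes from oddness in \<open>w\<close>, which reduces the lower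
  half plane to the upper one.
\<close>

section \<open>Lower bound for the denominator in a non-tangential cone\<close>

text \<open>The constant \<open>k < 1\<close> is the cosine of the angle that the cone keeps from
  the real axis. After factoring \<open>t^2 - w^2\<close> into \<open>t - w\<close> and
  \<open>t + w\<close>, the cone condition together with \<open>2 * |t| * |w| <= t^2 + |w|^2\<close>
  controls the cross term in the squared modulus of each factor.\<close>

lemma norm_diff_square_ge_cone:
  fixes w :: complex and t k :: real
  assumes "\<bar>Re w\<bar> \<le> k * norm w" "0 \<le> k" "k < 1"
  shows "(1 - k) * (t^2 + (norm w)^2) \<le> norm ((of_real t)^2 - w^2)"
proof -
  \<comment> \<open>Any \<open>s\<close> with \<open>s^2 = t^2\<close> is allowed, so one estimate
    serves both \<open>t\<close> and \<open>-t\<close>.\<close>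
  have *: "(1 - k) * (t^2 + (norm w)^2) \<le> (norm (of_real s - w))^2" if "s^2 = t^2" for s :: real
  proof -
    have "(norm (of_real s - w))^2 = s^2 - 2 * s * Re w + (norm w)^2"
      unfolding cmod_power2 by (simp add: power2_eq_square algebra_simps)
    moreover have "s * Re w \<le> k * (\<bar>s\<bar> * norm w)"
      using mult_left_mono[OF assms(1), of "\<bar>s\<bar>"] abs_ge_self[of "s * Re w"]
      by (simp add: abs_mult algebra_simps)
    moreover have "k * (2 * (\<bar>s\<bar> * norm w)) \<le> k * (s^2 + (norm w)^2)"
      using sum_squares_bound[of "\<bar>s\<bar>" "norm w"] assms(2) by (intro mult_left_mono) auto
    ultimately show ?thesis using that by (simp add: algebra_simps)
  qed
  have "((1 - k) * (t^2 + (norm w)^2))^2 \<le> (norm (of_real t - w))^2 * (norm (of_real (-t) - w))^2"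
    unfolding power2_eq_square[of "(1 - k) * _"] using assms by (intro mult_mono * ) auto
  \<comment> \<open>The two factors multiply to \<open>-(t^2 - w^2)\<close>, hence the sign change
    under the norm.\<close>
  also have "\<dots> = (norm ((of_real t)^2 - w^2))^2"
    unfolding power_mult_distrib[symmetric] norm_mult[symmetric]
    by (subst norm_minus_cancel[symmetric]) (simp add: power2_eq_square algebra_simps)
  finally show ?thesis by (rule power2_le_imp_le) simp
qed

section \<open>Kernel integrals over symmetric intervals by explicit primitives\<close>

lemma has_bochner_integral_lebesgue_FTC_Icc:
  fixes F :: "real \<Rightarrow> 'a::euclidean_space"
  assumes "a \<le> b"
    and "\<And>x. x \<in> {a..b} \<Longrightarrow> (F has_vector_derivative f x) (at x within {a..b})"
    and "continuous_on {a..b} f"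
  shows "has_bochner_integral lebesgue (\<lambda>x. indicator {a..b} x *\<^sub>R f x) (F b - F a)"
proof -
  have "has_bochner_integral lborel (\<lambda>x. indicator {a..b} x *\<^sub>R f x) (F b - F a)"
    using assms by (intro has_bochner_integral_FTC_Icc) auto
  moreover from this have "(\<lambda>x. indicator {a..b} x *\<^sub>R f x) \<in> borel_measurable lborel"
    by (auto simp: has_bochner_integral_iff)
  ultimately show ?thesis
    by (simp add: has_bochner_integral_iff integrable_completion integral_completion)
qed

text \<open>The primitive is \<open>arctan (t / s)\<close>, and the value
  \<open>2 * arctan (r / s)\<close> stays below \<open>pi\<close> for every height \<open>s\<close>.
  This uniformity makes the kernel a useful majorant when \<open>w\<close> tends to 0.\<close>

lemma integral_poisson_kernel_le:
  fixes s r :: real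
  assumes "0 < s" "0 \<le> r"
  shows "integrable lebesgue (\<lambda>t. indicator {-r..r} t *\<^sub>R (s / (t^2 + s^2)))"
    and "(LINT t:{-r..r}|lebesgue. s / (t^2 + s^2)) \<le> pi"
proof -
  have pos: "t^2 + s^2 > 0" for t using assms by (simp add: add_nonneg_pos)
  have "has_bochner_integral lebesgue (\<lambda>t. indicator {-r..r} t *\<^sub>R (s / (t^2 + s^2)))
          (arctan (r / s) - arctan (-r / s))"
  proof (rule has_bochner_integral_lebesgue_FTC_Icc)
    show "((\<lambda>t. arctan (t / s)) has_vector_derivative s / (t^2 + s^2)) (at t within {-r..r})" for t
      unfolding has_real_derivative_iff_has_vector_derivative[symmetric]
      using assms pos[of t]
      by (auto intro!: derivative_eq_intros simp: field_simps power2_eq_square)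
    show "continuous_on {-r..r} (\<lambda>t. s / (t^2 + s^2))"
      using pos by (intro continuous_intros) (metis less_irrefl)
  qed (use assms in auto)
  then show "integrable lebesgue (\<lambda>t. indicator {-r..r} t *\<^sub>R (s / (t^2 + s^2)))"
    and "(LINT t:{-r..r}|lebesgue. s / (t^2 + s^2)) \<le> pi"
    using arctan_ubound[of "r / s"]
    by (auto simp: has_bochner_integral_iff set_lebesgue_integral_def arctan_minus)
qed

text \<open>Partial fractions turn the kernel into \<open>(1 / (t - w) - 1 / (t + w)) / 2\<close>,
  so half a difference of logarithms is a primitive; constant factors inside \<open>Ln\<close> do
  not change its derivative.\<close>

lemma has_bochner_integral_cauchy_kernel_even:
  fixes w :: complex and r :: real
  assumes "Im w > 0" "0 \<le> r"
  shows "has_bochner_integral lebesgue (\<lambda>t. indicator {-r..r} t *\<^sub>R (w / ((of_real t)^2 - w^2)))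
    (Ln (\<i> * (of_real r - w)) - Ln (- \<i> * (of_real r + w)))"
proof -
  \<comment> \<open>both arguments of \<open>Ln\<close> have real part \<open>Im w > 0\<close>, so the branch cut is avoided\<close>
  define F where "F t = (Ln (\<i> * (of_real t - w)) - Ln (- \<i> * (of_real t + w))) / 2" for t :: real
  have nz: "complex_of_real t - w \<noteq> 0" "complex_of_real t + w \<noteq> 0" for t
    using assms(1) by (auto simp: complex_eq_iff)
  have nz2: "(complex_of_real t)^2 - w^2 \<noteq> 0" for t
    using nz[of t] by (metis mult_eq_0_iff power2_eq_square square_diff_square_factored)
  have "has_bochner_integral lebesgue (\<lambda>t. indicator {-r..r} t *\<^sub>R (w / ((of_real t)^2 - w^2))) (F r - F (-r))"
  proof (rule has_bochner_integral_lebesgue_FTC_Icc)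
    fix t :: real
    have "((\<lambda>z. (Ln (\<i> * (z - w)) - Ln (- \<i> * (z + w))) / 2) has_field_derivative
        (1 / (of_real t - w) - 1 / (of_real t + w)) / 2) (at (of_real t))"
      using assms(1) nz[of t]
      by (auto intro!: derivative_eq_intros simp: complex_nonpos_Reals_iff inverse_eq_divide)
    also have "(1 / (of_real t - w) - 1 / (of_real t + w)) / 2 = w / ((of_real t)^2 - w^2)"
      using nz[of t] nz2[of t] by (simp add: divide_simps) (simp add: power2_eq_square algebra_simps)
    finally have "((\<lambda>z. (Ln (\<i> * (z - w)) - Ln (- \<i> * (z + w))) / 2) has_field_derivative
        w / ((of_real t)^2 - w^2)) (at (of_real t))" .
    then show "(F has_vector_derivative (w / ((of_real t)^2 - w^2))) (at t within {-r..r})"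
      unfolding F_def by (rule has_vector_derivative_real_field[OF DERIV_subset]) auto
    show "continuous_on {-r..r} (\<lambda>t. w / ((of_real t)^2 - w^2))"
      using nz2 by (intro continuous_intros) auto
  qed (use assms in auto)
  \<comment> \<open>Reflection exchanges the two logarithms, so \<open>F\<close> is odd and its
    increment is \<open>2 * F r\<close>.\<close>
  moreover have "F r - F (-r) = Ln (\<i> * (of_real r - w)) - Ln (- \<i> * (of_real r + w))"
  proof -
    have "\<i> * (of_real (-r) - w) = - \<i> * (of_real r + w)" "- \<i> * (of_real (-r) + w) = \<i> * (of_real r - w)"
      by (simp_all add: algebra_simps)
    moreover have "(A - B) / 2 - (B - A) / 2 = A - B" for A B :: complex
      by (simp add: field_simps)
    ultimately show ?thesis by (simp only: F_def)
  qed
  ultimately show ?thesis by simp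
qed

text \<open>In the limit the logarithms have equal real parts, which cancel, and imaginary parts
  \<open>pi / 2\<close> and \<open>- pi / 2\<close>. What remains is independent of \<open>r\<close>
  and is the source of the jump term.\<close>

lemma LIMSEQ_integral_cauchy_kernel_even:
  fixes w :: "nat \<Rightarrow> complex" and r :: real
  assumes "\<And>n. Im (w n) > 0" "w \<longlonglongrightarrow> 0" "r > 0"
  shows "(\<lambda>n. LINT t:{-r..r}|lebesgue. w n / ((of_real t)^2 - (w n)^2)) \<longlonglongrightarrow> \<i> * pi"
proof -
  have "(\<lambda>n. Ln (\<i> * (of_real r - w n)) - Ln (- \<i> * (of_real r + w n)))
      \<longlonglongrightarrow> Ln (\<i> * (of_real r - 0)) - Ln (- \<i> * (of_real r + 0))"
    using \<open>r > 0\<close> by (intro tendsto_intros assms(2)) (auto simp: complex_nonpos_Reals_iff)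
  moreover have "Ln (\<i> * (of_real r - 0)) - Ln (- \<i> * (of_real r + 0)) = \<i> * pi"
  proof -
    have "Ln (\<i> * of_real r) = Ln (of_real r) + \<i> * pi/2"
      using \<open>r > 0\<close> Ln_times_of_real[of r "\<i>"] by (simp add: mult.commute Ln_of_real)
    moreover have "Ln (- \<i> * of_real r) = Ln (of_real r) - \<i> * pi/2"
      using \<open>r > 0\<close> Ln_times_of_real[of r "- \<i>"] by (simp add: mult.commute Ln_of_real)
    ultimately show ?thesis by simp
  qed
  ultimately show ?thesis
    using has_bochner_integral_cauchy_kernel_even[OF assms(1), of r] \<open>r > 0\<close>
    by (simp add: has_bochner_integral_iff set_lebesgue_integral_def)
qed

section \<open>Reflection in the origin and products with bounded kernels\<close>

lemma integral_lebesgue_symmetrize: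
  fixes F :: "real \<Rightarrow> complex"
  assumes "integrable lebesgue F"
  shows "integral\<^sup>L lebesgue F = (LINT t|lebesgue. (F t + F (-t)) / 2)"
proof -
  have "integrable lebesgue (\<lambda>t. F (-t))"
    using lebesgue_integrable_real_affine[OF assms, of "-1" 0] by simp
  moreover have "integral\<^sup>L lebesgue F = integral\<^sup>L lebesgue (\<lambda>t. F (-t))"
    using lebesgue_integral_real_affine[of "-1" F 0] by simp
  ultimately show ?thesis using assms by simp
qed


lemma integrable_mult_bounded:
  fixes f g :: "'a \<Rightarrow> complex"
  assumes "integrable M f" "g \<in> borel_measurable M" "\<And>x. norm (g x) \<le> C"
  shows "integrable M (\<lambda>x. f x * g x)"
proof (rule Bochner_Integration.integrable_bound)
  show "integrable M (\<lambda>x. C * norm (f x))" using assms(1) by simp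
  show "(\<lambda>x. f x * g x) \<in> borel_measurable M" using assms by measurable
  show "AE x in M. norm (f x * g x) \<le> norm (C * norm (f x))"
    using mult_right_mono[OF assms(3) norm_ge_zero]
    by (auto simp: norm_mult mult.commute intro!: AE_I2 order_trans[OF _ abs_ge_self])
qed

section \<open>The even kernel as an approximate identity\<close>

text \<open>Inside the cone the even kernel is dominated by a multiple of the Poisson kernel at
  height \<open>norm w\<close>, whose mass is bounded uniformly in \<open>w\<close>.\<close>

lemma norm_cauchy_kernel_even_le:
  fixes w :: complex and t k :: real
  assumes "\<bar>Re w\<bar> \<le> k * norm w" "0 \<le> k" "k < 1" "w \<noteq> 0"
  shows "norm (w / ((of_real t)^2 - w^2)) \<le> norm w / (t^2 + (norm w)^2) / (1 - k)"
proof -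
  have "0 < (1 - k) * (t^2 + (norm w)^2)" using assms by (simp add: add_nonneg_pos)
  then show ?thesis
    using norm_diff_square_ge_cone[OF assms(1-3), of t]
    by (simp add: norm_divide mult.commute frac_le)
qed

text \<open>This bound degenerates as \<open>w\<close> tends to 0; it provides integrability against
  the kernel for each fixed \<open>w\<close>.\<close>

lemma norm_cauchy_kernel_even_le_const:
  fixes w :: complex and t k :: real
  assumes "\<bar>Re w\<bar> \<le> k * norm w" "0 \<le> k" "k < 1" "w \<noteq> 0"
  shows "norm (w / ((of_real t)^2 - w^2)) \<le> norm w / (norm w)^2 / (1 - k)"
proof -
  have "norm w / (t^2 + (norm w)^2) / (1 - k) \<le> norm w / (norm w)^2 / (1 - k)"
    using assms by (intro divide_right_mono divide_left_mono) (auto simp: add_nonneg_pos)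
  then show ?thesis using norm_cauchy_kernel_even_le[OF assms, of t] by linarith
qed

lemma borel_measurable_cauchy_kernel:
  "(\<lambda>t. w / ((of_real t)^2 - w^2)) \<in> borel_measurable lebesgue"
  "(\<lambda>t. (of_real t)^2 / ((of_real t)^2 - w^2)) \<in> borel_measurable lebesgue"
  "(\<lambda>t. 1 / (of_real t - w)) \<in> borel_measurable lebesgue"
  for w :: complex
  by (rule measurable_completion, simp)+

text \<open>Near 0 the factor \<open>d\<close> is small and the kernel has bounded mass; away from 0
  the kernel is of order \<open>norm (w n)\<close> and \<open>d\<close> has finite
  \<open>L^1\<close> norm.\<close>

lemma LIMSEQ_integral_cauchy_kernel_even_vanishing:
  fixes d :: "real \<Rightarrow> complex" and w :: "nat \<Rightarrow> complex"
  assumes d: "integrable lebesgue d" "(d \<longlongrightarrow> 0) (at 0)" "d 0 = 0"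
    and w: "\<And>n. w n \<noteq> 0" "w \<longlonglongrightarrow> 0"
    and cone: "\<And>n. \<bar>Re (w n)\<bar> \<le> k * norm (w n)" "0 \<le> k" "k < 1"
  shows "(\<lambda>n. LINT t|lebesgue. d t * (w n / ((of_real t)^2 - (w n)^2))) \<longlonglongrightarrow> 0"
proof (rule LIMSEQ_I)
  fix \<epsilon> :: real assume "\<epsilon> > 0"
  \<comment> \<open>Chosen so that Poisson mass \<open>pi\<close> and cone factor
    \<open>1 / (1 - k)\<close> together give \<open>\<epsilon> / 2\<close>.\<close>
  define \<epsilon>' where "\<epsilon>' = (1 - k) * (\<epsilon> / (2 * pi))"
  have "\<epsilon>' > 0" using \<open>\<epsilon> > 0\<close> cone by (simp add: \<epsilon>'_def)
  \<comment> \<open>The value \<open>d 0 = 0\<close> extends the punctured limit to a bound that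
    also covers \<open>t = 0\<close>.\<close>
  obtain \<eta>0 where \<eta>0: "\<eta>0 > 0" "\<And>t. \<bar>t\<bar> < \<eta>0 \<Longrightarrow> norm (d t) < \<epsilon>'"
    using LIM_D[OF d(2) \<open>\<epsilon>' > 0\<close>] d(3) \<open>\<epsilon>' > 0\<close> by (metis diff_zero norm_zero real_norm_def)
  \<comment> \<open>The cap at 1 places the near zone inside \<open>{-1..1}\<close>, where the
    Poisson majorant lives.\<close>
  define \<eta> where "\<eta> = min \<eta>0 1"
  have \<eta>: "\<eta> > 0" "\<eta> \<le> 1" "\<And>t. \<bar>t\<bar> < \<eta> \<Longrightarrow> norm (d t) < \<epsilon>'" using \<eta>0 by (auto simp: \<eta>_def)
  define D where "D = (LINT t|lebesgue. norm (d t))"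
  have bound: "norm (LINT t|lebesgue. d t * (w n / ((of_real t)^2 - (w n)^2)))
      \<le> \<epsilon> / 2 + norm (w n) / \<eta>^2 / (1 - k) * D" for n
  proof -
    define s where "s = norm (w n)"
    have "s > 0" using w(1) by (simp add: s_def)
    note P = integral_poisson_kernel_le[OF \<open>s > 0\<close>, of 1]
    let ?P = "\<lambda>t. indicator {-1..1} t *\<^sub>R (s / (t^2 + s^2))"
    \<comment> \<open>The first summand handles \<open>|t| < \<eta>\<close>, the second the rest.
      Both are nonnegative, so their sum is a majorant everywhere.\<close>
    let ?B = "\<lambda>t. \<epsilon>' / (1 - k) * ?P t + s / \<eta>^2 / (1 - k) * norm (d t)"
    have "norm (LINT t|lebesgue. d t * (w n / ((of_real t)^2 - (w n)^2))) \<le> integral\<^sup>L lebesgue ?B"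
    proof (rule Bochner_Integration.integral_norm_bound_integral)
      show "integrable lebesgue (\<lambda>t. d t * (w n / ((of_real t)^2 - (w n)^2)))"
        using norm_cauchy_kernel_even_le_const[OF cone w(1)]
        by (intro integrable_mult_bounded d borel_measurable_cauchy_kernel)
      show "integrable lebesgue ?B" using P(1) d(1) by (intro Bochner_Integration.integrable_add integrable_mult_right) auto
      fix t :: real
      have K: "norm (d t * (w n / ((of_real t)^2 - (w n)^2))) \<le> norm (d t) * (s / (t^2 + s^2) / (1 - k))"
        unfolding norm_mult s_def by (intro mult_left_mono norm_cauchy_kernel_even_le cone w) auto
      show "norm (d t * (w n / ((of_real t)^2 - (w n)^2))) \<le> ?B t"
      proof (cases "\<bar>t\<bar> < \<eta>")
        case True
        have "norm (d t) * (s / (t^2 + s^2) / (1 - k)) \<le> \<epsilon>' * (s / (t^2 + s^2) / (1 - k))"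
          using \<eta>(3)[OF True] \<open>s > 0\<close> cone by (intro mult_right_mono) auto
        moreover have "0 \<le> s / \<eta>^2 / (1 - k) * norm (d t)" using \<open>s > 0\<close> cone by simp
        moreover have "t \<in> {-1..1}" using True \<eta>(2) by auto
        ultimately show ?thesis using K by (simp add: mult_ac)
      next
        case False
        have "\<eta>^2 \<le> t^2" using False \<eta>(1) by (simp add: abs_le_square_iff[symmetric])
        then have "s / (t^2 + s^2) / (1 - k) \<le> s / \<eta>^2 / (1 - k)"
          using \<eta>(1) \<open>s > 0\<close> cone
          by (intro divide_right_mono divide_left_mono) (auto intro!: mult_pos_pos add_pos_pos add_increasing2 simp: add_nonneg_pos)
        then have "norm (d t) * (s / (t^2 + s^2) / (1 - k)) \<le> norm (d t) * (s / \<eta>^2 / (1 - k))"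
          by (rule mult_left_mono) simp
        moreover have "0 \<le> \<epsilon>' / (1 - k) * ?P t"
          using \<open>\<epsilon>' > 0\<close> \<open>s > 0\<close> cone by simp
        ultimately show ?thesis using K by (simp add: mult_ac)
      qed
    qed
    also have "\<dots> = (LINT t|lebesgue. \<epsilon>' / (1 - k) * ?P t) + (LINT t|lebesgue. s / \<eta>^2 / (1 - k) * norm (d t))"
      using d(1) by (intro Bochner_Integration.integral_add integrable_mult_right P(1)) auto
    also have "\<dots> = \<epsilon>' / (1 - k) * (LINT t:{-1..1}|lebesgue. s / (t^2 + s^2)) + s / \<eta>^2 / (1 - k) * D"
      by (simp only: D_def set_lebesgue_integral_def integral_mult_right_zero)
    also have "\<epsilon>' / (1 - k) * (LINT t:{-1..1}|lebesgue. s / (t^2 + s^2)) \<le> \<epsilon>' / (1 - k) * pi"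
      using P(2) \<open>\<epsilon>' > 0\<close> cone by (intro mult_left_mono) auto
    also have "\<epsilon>' / (1 - k) * pi = \<epsilon> / 2" using cone by (simp add: \<epsilon>'_def)
    finally show ?thesis by (simp add: s_def)
  qed
  have "(\<lambda>n. norm (w n) / \<eta>^2 / (1 - k) * D) \<longlonglongrightarrow> norm (0::complex) / \<eta>^2 / (1 - k) * D"
    using \<eta>(1) cone by (intro tendsto_intros w) auto
  then have "\<forall>\<^sub>F n in sequentially. norm (w n) / \<eta>^2 / (1 - k) * D < \<epsilon> / 2"
    using \<open>\<epsilon> > 0\<close> by (intro order_tendstoD) auto
  then obtain N where N: "\<And>n. n \<ge> N \<Longrightarrow> norm (w n) / \<eta>^2 / (1 - k) * D < \<epsilon> / 2"
    unfolding eventually_sequentially by blast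
  then have "norm (LINT t|lebesgue. d t * (w n / ((of_real t)^2 - (w n)^2))) < \<epsilon>" if "n \<ge> N" for n
    using bound[of n] N[OF that] by linarith
  then show "\<exists>N. \<forall>n\<ge>N. norm ((LINT t|lebesgue. d t * (w n / ((of_real t)^2 - (w n)^2))) - 0) < \<epsilon>"
    by auto
qed

text \<open>The value \<open>e 0\<close> is split off: its contribution is the explicit kernel
  integral, while the remainder vanishes at 0 and contributes nothing in the limit.\<close>

lemma LIMSEQ_integral_cauchy_kernel_even_isCont:
  fixes e :: "real \<Rightarrow> complex" and w :: "nat \<Rightarrow> complex"
  assumes e: "integrable lebesgue e" "isCont e 0"
    and w: "\<And>n. Im (w n) > 0" "w \<longlonglongrightarrow> 0"
    and cone: "\<And>n. \<bar>Re (w n)\<bar> \<le> k * norm (w n)" "0 \<le> k" "k < 1"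
  shows "(\<lambda>n. LINT t|lebesgue. e t * (w n / ((of_real t)^2 - (w n)^2))) \<longlonglongrightarrow> \<i> * pi * e 0"
proof -
  \<comment> \<open>The constant is cut off to \<open>{-1..1}\<close> to keep it integrable; the
    cutoff equals 1 near 0, so \<open>d\<close> still tends to 0 there.\<close>
  define d where "d t = e t - indicator {-1..1} t *\<^sub>R e 0" for t
  have nz: "w n \<noteq> 0" for n using w(1)[of n] by auto
  have I: "integrable lebesgue (\<lambda>t. indicator {-1..1::real} t *\<^sub>R e 0)"
    by (intro integrable_scaleR_left integrable_real_indicator) auto
  then have d: "integrable lebesgue d" unfolding d_def using e(1) by simp
  have K: "has_bochner_integral lebesgue (\<lambda>t. indicator {-1..1} t *\<^sub>R (w n / ((of_real t)^2 - (w n)^2)))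
      (LINT t:{-1..1}|lebesgue. w n / ((of_real t)^2 - (w n)^2))" for n
    using has_bochner_integral_cauchy_kernel_even[OF w(1), of 1]
    by (auto simp: set_lebesgue_integral_def has_bochner_integral_iff)
  have "((\<lambda>t. e t - e 0) \<longlongrightarrow> 0) (at 0)"
    using e(2) by (simp add: isCont_def LIM_zero)
  moreover have "\<forall>\<^sub>F t in at 0. e t - e 0 = d t"
    by (rule eventually_mono[OF eventually_at_in_open'[of "{-1<..<1}"]]) (auto simp: d_def)
  ultimately have "(d \<longlongrightarrow> 0) (at 0)" by (rule Lim_transform_eventually)
  moreover have "d 0 = 0" by (simp add: d_def)
  ultimately have "(\<lambda>n. LINT t|lebesgue. d t * (w n / ((of_real t)^2 - (w n)^2))) \<longlonglongrightarrow> 0"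
    using d nz w(2) cone by (intro LIMSEQ_integral_cauchy_kernel_even_vanishing[where k = k])
  moreover have "(\<lambda>n. LINT t:{-1..1}|lebesgue. w n / ((of_real t)^2 - (w n)^2)) \<longlonglongrightarrow> \<i> * pi"
    by (intro LIMSEQ_integral_cauchy_kernel_even w) auto
  ultimately have "(\<lambda>n. (LINT t|lebesgue. d t * (w n / ((of_real t)^2 - (w n)^2))) +
      e 0 * (LINT t:{-1..1}|lebesgue. w n / ((of_real t)^2 - (w n)^2))) \<longlonglongrightarrow> 0 + e 0 * (\<i> * pi)"
    by (intro tendsto_intros)
  also have "(\<lambda>n. (LINT t|lebesgue. d t * (w n / ((of_real t)^2 - (w n)^2))) +
      e 0 * (LINT t:{-1..1}|lebesgue. w n / ((of_real t)^2 - (w n)^2))) =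
      (\<lambda>n. LINT t|lebesgue. e t * (w n / ((of_real t)^2 - (w n)^2)))"
  proof
    fix n
    have "integrable lebesgue (\<lambda>t. d t * (w n / ((of_real t)^2 - (w n)^2)))"
      using norm_cauchy_kernel_even_le_const[OF cone nz]
      by (intro integrable_mult_bounded d borel_measurable_cauchy_kernel)
    then have "(LINT t|lebesgue. d t * (w n / ((of_real t)^2 - (w n)^2))) +
      (LINT t|lebesgue. e 0 * (indicator {-1..1} t *\<^sub>R (w n / ((of_real t)^2 - (w n)^2))))
      = (LINT t|lebesgue. d t * (w n / ((of_real t)^2 - (w n)^2)) +
        e 0 * (indicator {-1..1} t *\<^sub>R (w n / ((of_real t)^2 - (w n)^2))))"
      using K[of n]
      by (intro Bochner_Integration.integral_add[symmetric] integrable_mult_right) (auto simp: has_bochner_integral_iff)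
    also have "\<dots> = (LINT t|lebesgue. e t * (w n / ((of_real t)^2 - (w n)^2)))"
      by (intro Bochner_Integration.integral_cong) (auto simp: d_def algebra_simps diff_divide_distrib indicator_def)
    finally show "(LINT t|lebesgue. d t * (w n / ((of_real t)^2 - (w n)^2))) +
      e 0 * (LINT t:{-1..1}|lebesgue. w n / ((of_real t)^2 - (w n)^2)) =
      (LINT t|lebesgue. e t * (w n / ((of_real t)^2 - (w n)^2)))"
      by (simp only: set_lebesgue_integral_def integral_mult_right_zero)
  qed
  finally show ?thesis by (simp add: mult.commute)
qed

section \<open>The odd kernel and dominated convergence\<close>

text \<open>Dropping \<open>(norm w)^2\<close> from the cone estimate leaves a bound uniform in both
  \<open>t\<close> and \<open>w\<close>; it supplies the dominating function for the odd
  part.\<close>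

lemma norm_cauchy_kernel_odd_le:
  fixes w :: complex and t k :: real
  assumes "\<bar>Re w\<bar> \<le> k * norm w" "0 \<le> k" "k < 1" "w \<noteq> 0"
  shows "norm ((of_real t)^2 / ((of_real t)^2 - w^2)) \<le> 1 / (1 - k)"
proof -
  have "0 < (1 - k) * (t^2 + (norm w)^2)" using assms by (simp add: add_nonneg_pos)
  moreover have "(1 - k) * t^2 \<le> norm ((of_real t)^2 - w^2)"
    by (rule order_trans[OF _ norm_diff_square_ge_cone[OF assms(1-3), of t]])
       (use assms in \<open>auto intro!: mult_left_mono\<close>)
  ultimately show ?thesis
    using norm_diff_square_ge_cone[OF assms(1-3), of t] assms
    by (simp add: norm_divide norm_power divide_simps mult.commute)
qed

lemma LIMSEQ_integral_cauchy_kernel_odd: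
  fixes q :: "real \<Rightarrow> complex" and w :: "nat \<Rightarrow> complex"
  assumes q: "integrable lebesgue q"
    and w: "\<And>n. w n \<noteq> 0" "w \<longlonglongrightarrow> 0"
    and cone: "\<And>n. \<bar>Re (w n)\<bar> \<le> k * norm (w n)" "0 \<le> k" "k < 1"
  shows "(\<lambda>n. LINT t|lebesgue. q t * ((of_real t)^2 / ((of_real t)^2 - (w n)^2))) \<longlonglongrightarrow> integral\<^sup>L lebesgue q"
proof (rule integral_dominated_convergence)
  show "q \<in> borel_measurable lebesgue" using q by simp
  show "(\<lambda>t. q t * ((of_real t)^2 / ((of_real t)^2 - (w n)^2))) \<in> borel_measurable lebesgue" for n
    using q borel_measurable_cauchy_kernel(2)[of "w n"] by (intro borel_measurable_times) auto
  show "integrable lebesgue (\<lambda>t. norm (q t) * (1 / (1 - k)))" using q by simp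
  \<comment> \<open>At \<open>t = 0\<close> the integrand is 0 for every \<open>n\<close>, whatever
    \<open>q 0\<close> is, so the origin is discarded as a null set.\<close>
  have "AE t in lebesgue. (t::real) \<noteq> 0"
    by (intro AE_completion AE_lborel_singleton)
  then show "AE t in lebesgue. (\<lambda>n. q t * ((of_real t)^2 / ((of_real t)^2 - (w n)^2))) \<longlonglongrightarrow> q t"
  proof eventually_elim
    case (elim t)
    have "(\<lambda>n. q t * ((of_real t)^2 / ((of_real t)^2 - (w n)^2))) \<longlonglongrightarrow>
        q t * ((of_real t)^2 / ((of_real t)^2 - 0^2))"
      using elim by (intro tendsto_intros w) auto
    then show ?case using elim by simp
  qed
  show "AE t in lebesgue. norm (q t * ((of_real t)^2 / ((of_real t)^2 - (w n)^2))) \<le> norm (q t) * (1 / (1 - k))" for n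
    unfolding norm_mult by (intro AE_I2 mult_left_mono norm_cauchy_kernel_odd_le cone w) auto
qed

section \<open>Boundary values at the origin\<close>

text \<open>Averaging the integrand with its reflection pairs odd parts with odd parts and even with
  even. In the odd term a factor \<open>t\<close> is moved into the kernel, so that the integrable
  quotient of the odd part of \<open>h\<close> by \<open>t\<close> appears.\<close>

lemma integral_cauchy_kernel_split:
  fixes h :: "real \<Rightarrow> complex" and w :: complex
  assumes h: "integrable lebesgue h" "integrable lebesgue (\<lambda>t. (h t - h (-t)) / 2 / of_real t)"
    and w: "Im w \<noteq> 0" and cone: "\<bar>Re w\<bar> \<le> k * norm w" "0 \<le> k" "k < 1"
  shows "(LINT t|lebesgue. h t / (of_real t - w)) =
    (LINT t|lebesgue. (h t - h (-t)) / 2 / of_real t * ((of_real t)^2 / ((of_real t)^2 - w^2))) +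
    (LINT t|lebesgue. (h t + h (-t)) / 2 * (w / ((of_real t)^2 - w^2)))"
proof -
  have nz: "complex_of_real t - w \<noteq> 0" "complex_of_real t + w \<noteq> 0" for t
    using w by (auto simp: complex_eq_iff)
  have w0: "w \<noteq> 0" using w by auto
  have nz2: "(complex_of_real t)^2 - w^2 \<noteq> 0" for t
    using nz[of t] by (metis mult_eq_0_iff power2_eq_square square_diff_square_factored)
  have alg: "(x * ((p + u) / D) + y * ((- p + u) / D)) / 2 = (x - y) / 2 * (p / D) + (x + y) / 2 * (u / D)"
    for x y p u D :: complex by (cases "D = 0") (simp_all add: field_simps)
  have h': "integrable lebesgue (\<lambda>t. h (-t))"
    using lebesgue_integrable_real_affine[OF h(1), of "-1" 0] by simp
  have "norm (1 / (complex_of_real t - w)) \<le> 1 / \<bar>Im w\<bar>" for t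
    using abs_Im_le_cmod[of "complex_of_real t - w"] w by (simp add: norm_divide frac_le)
  then have "integrable lebesgue (\<lambda>t. h t * (1 / (of_real t - w)))"
    by (intro integrable_mult_bounded h borel_measurable_cauchy_kernel)
  then have "(LINT t|lebesgue. h t / (of_real t - w)) =
     (LINT t|lebesgue. (h t / (of_real t - w) + h (-t) / (of_real (-t) - w)) / 2)"
    by (intro integral_lebesgue_symmetrize) simp
  also have "\<dots> = (LINT t|lebesgue. (h t - h (-t)) / 2 / of_real t * ((of_real t)^2 / ((of_real t)^2 - w^2)) +
    (h t + h (-t)) / 2 * (w / ((of_real t)^2 - w^2)))"
  proof (intro Bochner_Integration.integral_cong refl)
    fix t :: real
    have pf: "1 / (of_real t - w) = (of_real t + w) / ((of_real t)^2 - w^2)"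
       "1 / (of_real (-t) - w) = (- of_real t + w) / ((of_real t)^2 - w^2)"
      using nz[of t] nz[of "-t"] nz2[of t] by (simp_all add: frac_eq_eq power2_eq_square algebra_simps)
    have "(h t / (of_real t - w) + h (-t) / (of_real (-t) - w)) / 2 =
       (h t * (1 / (of_real t - w)) + h (-t) * (1 / (of_real (-t) - w))) / 2" by simp
    also have "\<dots> = (h t - h (-t)) / 2 * (of_real t / ((of_real t)^2 - w^2)) +
       (h t + h (-t)) / 2 * (w / ((of_real t)^2 - w^2))"
      unfolding pf by (rule alg)
    \<comment> \<open>At \<open>t = 0\<close> both sides are 0, since division by zero yields
      0.\<close>
    also have "(h t - h (-t)) / 2 * (of_real t / ((of_real t)^2 - w^2)) =
       (h t - h (-t)) / 2 / of_real t * ((of_real t)^2 / ((of_real t)^2 - w^2))"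
      by (cases "t = 0") (simp_all add: power2_eq_square)
    finally show "(h t / (of_real t - w) + h (-t) / (of_real (-t) - w)) / 2 = \<dots> +
       (h t + h (-t)) / 2 * (w / ((of_real t)^2 - w^2))" .
  qed
  also have "\<dots> = (LINT t|lebesgue. (h t - h (-t)) / 2 / of_real t * ((of_real t)^2 / ((of_real t)^2 - w^2))) +
    (LINT t|lebesgue. (h t + h (-t)) / 2 * (w / ((of_real t)^2 - w^2)))"
  proof (rule Bochner_Integration.integral_add)
    show "integrable lebesgue (\<lambda>t. (h t - h (-t)) / 2 / of_real t * ((of_real t)^2 / ((of_real t)^2 - w^2)))"
      using norm_cauchy_kernel_odd_le[OF cone w0]
      by (intro integrable_mult_bounded h borel_measurable_cauchy_kernel)
    show "integrable lebesgue (\<lambda>t. (h t + h (-t)) / 2 * (w / ((of_real t)^2 - w^2)))"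
      using norm_cauchy_kernel_even_le_const[OF cone w0] h(1) h'
      by (intro integrable_mult_bounded borel_measurable_cauchy_kernel) auto
  qed
  finally show ?thesis .
qed

text \<open>The sign \<open>\<sigma>\<close> records the half plane, and
  \<open>\<sigma> * w n\<close> always lies in the upper one. The odd kernel depends only on the
  square of \<open>w n\<close>, so the sign affects the local term alone.\<close>

lemma LIMSEQ_integral_cauchy_kernel:
  fixes h :: "real \<Rightarrow> complex" and w :: "nat \<Rightarrow> complex" and \<sigma> :: real
  assumes h: "integrable lebesgue h" "integrable lebesgue (\<lambda>t. (h t - h (-t)) / 2 / of_real t)" "isCont h 0"
    and w: "\<And>n. \<sigma> * Im (w n) > 0" "w \<longlonglongrightarrow> 0" "\<sigma> = 1 \<or> \<sigma> = -1"
    and cone: "\<And>n. \<bar>Re (w n)\<bar> \<le> k * norm (w n)" "0 \<le> k" "k < 1"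
  shows "(\<lambda>n. LINT t|lebesgue. h t / (of_real t - w n)) \<longlonglongrightarrow>
    \<sigma> * (\<i> * pi * h 0) + (LINT t|lebesgue. (h t - h (-t)) / 2 / of_real t)"
proof -
  define v where "v n = \<sigma> * w n" for n
  have v2: "(v n)^2 = (w n)^2" and vw: "w n = \<sigma> * v n" for n using w(3) by (auto simp: v_def)
  have im: "Im (w n) \<noteq> 0" for n using w(1)[of n] by auto
  have h': "integrable lebesgue (\<lambda>t. h (-t))"
    using lebesgue_integrable_real_affine[OF h(1), of "-1" 0] by simp
  have "isCont (\<lambda>t. (h t + h (-t)) / 2) 0"
    using h(3) isCont_o2[of 0 uminus h] by (intro isCont_divide isCont_add) auto
  moreover have "v \<longlonglongrightarrow> 0" unfolding v_def by (rule tendsto_mult_right_zero) (rule w(2))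
  moreover have "\<bar>Re (v n)\<bar> \<le> k * norm (v n)" for n
    using cone(1)[of n] w(3) by (auto simp: v_def)
  ultimately have "(\<lambda>n. LINT t|lebesgue. (h t + h (-t)) / 2 * (v n / ((of_real t)^2 - (v n)^2)))
      \<longlonglongrightarrow> \<i> * pi * ((h 0 + h (-0)) / 2)"
    using h(1) h' cone(2,3) w(1)
    by (intro LIMSEQ_integral_cauchy_kernel_even_isCont[where k = k and w = v]) (auto simp: v_def[THEN arg_cong[where f = Im]])
  then have "(\<lambda>n. \<sigma> * (LINT t|lebesgue. (h t + h (-t)) / 2 * (v n / ((of_real t)^2 - (v n)^2))))
      \<longlonglongrightarrow> \<sigma> * (\<i> * pi * h 0)"
    by (intro tendsto_mult_left) simp
  then have "(\<lambda>n. LINT t|lebesgue. (h t + h (-t)) / 2 * (w n / ((of_real t)^2 - (w n)^2)))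
      \<longlonglongrightarrow> \<sigma> * (\<i> * pi * h 0)"
    unfolding v2 by (subst vw) (simp flip: integral_mult_right_zero add: mult_ac)
  moreover have "(\<lambda>n. LINT t|lebesgue. (h t - h (-t)) / 2 / of_real t * ((of_real t)^2 / ((of_real t)^2 - (w n)^2)))
      \<longlonglongrightarrow> (LINT t|lebesgue. (h t - h (-t)) / 2 / of_real t)"
    using im by (intro LIMSEQ_integral_cauchy_kernel_odd[where k = k] h w cone) (metis zero_complex.sel(2))
  ultimately show ?thesis
    unfolding integral_cauchy_kernel_split[OF h(1,2) im cone] by (subst add.commute) (rule tendsto_add)
qed

section \<open>The principal value as an integral of the odd part\<close>

text \<open>The truncation set is invariant under reflection, so symmetrizing leaves the odd part
  over \<open>t\<close> on \<open>\<delta> \<le> |t|\<close>; its integrability lets dominated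
  convergence remove the truncation.\<close>

lemma tendsto_truncated_integral_odd_part:
  fixes h :: "real \<Rightarrow> complex"
  assumes h: "integrable lebesgue h" "integrable lebesgue (\<lambda>t. (h t - h (-t)) / 2 / of_real t)"
  shows "((\<lambda>\<delta>. LINT t|lebesgue. h t * (indicator {t. \<delta> \<le> \<bar>t\<bar>} t / of_real t)) \<longlongrightarrow>
    (LINT t|lebesgue. (h t - h (-t)) / 2 / of_real t)) (at_right 0)"
proof -
  define q where "q t = (h t - h (-t)) / 2 / of_real t" for t
  have S: "{t::real. \<delta> \<le> \<bar>t\<bar>} \<in> sets lebesgue" for \<delta> by simp
  \<comment> \<open>the substitution \<open>\<delta> = inverse x\<close> makes dominated convergence along \<open>at_top\<close> applicable\<close>
  have "((\<lambda>x. LINT t|lebesgue. indicator {t. inverse x \<le> \<bar>t\<bar>} t *\<^sub>R q t) \<longlongrightarrow> integral\<^sup>L lebesgue q) at_top"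
  proof (rule integral_dominated_convergence_at_top)
    show "q \<in> borel_measurable lebesgue" "integrable lebesgue (\<lambda>t. norm (q t))"
      using h(2)[folded q_def] by auto
    then show "(\<lambda>t. indicator {t. inverse x \<le> \<bar>t\<bar>} t *\<^sub>R q t) \<in> borel_measurable lebesgue" for x
      using S by (intro borel_measurable_scaleR borel_measurable_indicator) auto
    show "\<forall>\<^sub>F x in at_top. AE t in lebesgue. norm (indicator {t. inverse x \<le> \<bar>t\<bar>} t *\<^sub>R q t) \<le> norm (q t)"
      by (intro always_eventually allI AE_I2) (auto simp: indicator_def)
    show "AE t in lebesgue. ((\<lambda>x. indicator {t. inverse x \<le> \<bar>t\<bar>} t *\<^sub>R q t) \<longlongrightarrow> q t) at_top"
    proof (rule AE_I2)
      \<comment> \<open>Convergence holds even at \<open>t = 0\<close>, because division by zero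
        makes \<open>q 0 = 0\<close>.\<close>
      fix t :: real
      show "((\<lambda>x. indicator {t. inverse x \<le> \<bar>t\<bar>} t *\<^sub>R q t) \<longlongrightarrow> q t) at_top"
      proof (cases "t = 0")
        case False
        have "\<forall>\<^sub>F x in at_top. inverse x \<le> \<bar>t\<bar>"
          using order_tendstoD(2)[OF tendsto_inverse_0_at_top[OF filterlim_ident], of "\<bar>t\<bar>"] False
          by (auto elim: eventually_mono)
        then show ?thesis by (intro tendsto_eventually) (auto elim: eventually_mono)
      qed (simp add: q_def)
    qed
  qed
  then have "((\<lambda>\<delta>. LINT t|lebesgue. indicator {t. \<delta> \<le> \<bar>t\<bar>} t *\<^sub>R q t) \<longlongrightarrow> integral\<^sup>L lebesgue q) (at_right 0)"
    by (simp add: filterlim_at_right_to_top)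
  moreover have "\<forall>\<^sub>F \<delta> in at_right 0. (LINT t|lebesgue. indicator {t. \<delta> \<le> \<bar>t\<bar>} t *\<^sub>R q t) =
     (LINT t|lebesgue. h t * (indicator {t. \<delta> \<le> \<bar>t\<bar>} t / of_real t))"
    using eventually_at_right_less
  proof eventually_elim
    case (elim \<delta>)
    let ?I = "indicator {t. \<delta> \<le> \<bar>t\<bar>} :: real \<Rightarrow> complex"
    have "norm (?I t / of_real t) \<le> 1 / \<delta>" for t
      using elim by (auto simp: indicator_def norm_divide frac_le)
    moreover have "(\<lambda>t. ?I t / of_real t) \<in> borel_measurable lebesgue"
      by (rule measurable_completion) simp
    ultimately have "integrable lebesgue (\<lambda>t. h t * (?I t / of_real t))"
      by (intro integrable_mult_bounded h)
    then have "(LINT t|lebesgue. h t * (?I t / of_real t)) =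
        (LINT t|lebesgue. (h t * (?I t / of_real t) + h (-t) * (?I (-t) / of_real (-t))) / 2)"
      by (rule integral_lebesgue_symmetrize)
    also have "\<dots> = (LINT t|lebesgue. indicator {t. \<delta> \<le> \<bar>t\<bar>} t *\<^sub>R q t)"
      by (intro Bochner_Integration.integral_cong)
         (auto simp: q_def indicator_def diff_divide_distrib add_divide_distrib mult.commute)
    finally show ?case by simp
  qed
  ultimately show ?thesis unfolding q_def by (rule Lim_transform_eventually)
qed

section \<open>From argument bounds to a cone condition\<close>

text \<open>In polar form the real part is the modulus times the cosine of the argument, so
  \<open>k = cos \<epsilon>\<close> works in both half planes.\<close>

lemma converges_nontangentially_cone:
  assumes "converges_nontangentially z \<tau>"
  obtains k where "0 \<le> k" "k < 1" "\<And>n. \<bar>Re (z n - of_real \<tau>)\<bar> \<le> k * norm (z n - of_real \<tau>)"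
proof -
  obtain \<epsilon> where \<epsilon>: "\<epsilon> > 0" and arg: "\<And>n. Arg2pi (z n - of_real \<tau>) \<in> {\<epsilon><..<pi - \<epsilon>} \<or>
      Arg2pi (z n - of_real \<tau>) \<in> {pi + \<epsilon><..<2 * pi - \<epsilon>}"
    using assms unfolding converges_nontangentially_def by blast
  \<comment> \<open>Each range of angles has length \<open>pi - 2 * \<epsilon>\<close> and contains
    the argument for index 0, so it is nonempty.\<close>
  have "\<epsilon> < pi / 2" using arg[of 0] by auto
  have c: "\<bar>cos \<theta>\<bar> \<le> cos \<epsilon>" if "\<epsilon> < \<theta>" "\<theta> < pi - \<epsilon>" for \<theta>
    using cos_monotone_0_pi[of \<epsilon> \<theta>] cos_monotone_0_pi[of \<theta> "pi - \<epsilon>"] that \<epsilon> by (auto simp: abs_le_iff)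
  have "\<bar>Re (z n - of_real \<tau>)\<bar> \<le> cos \<epsilon> * norm (z n - of_real \<tau>)" for n
  proof -
    let ?w = "z n - of_real \<tau>"
    \<comment> \<open>Subtracting \<open>pi\<close> carries the lower range to the upper one and
      only flips the sign of the cosine.\<close>
    have "\<bar>cos (Arg2pi ?w)\<bar> \<le> cos \<epsilon>"
      using arg[of n] c[of "Arg2pi ?w"] c[of "Arg2pi ?w - pi"] by (auto simp: cos_diff)
    then have "norm ?w * \<bar>cos (Arg2pi ?w)\<bar> \<le> norm ?w * cos \<epsilon>"
      by (intro mult_left_mono) auto
    moreover have "Re ?w = norm ?w * cos (Arg2pi ?w)"
      by (subst Arg2pi_eq) (simp add: Re_exp)
    ultimately show ?thesis by (metis abs_mult abs_norm_cancel mult.commute)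
  qed
  moreover have "0 \<le> cos \<epsilon>" using \<epsilon> \<open>\<epsilon> < pi / 2\<close> by (intro cos_ge_zero) auto
  moreover have "cos \<epsilon> < 1" using cos_monotone_0_pi[of 0 \<epsilon>] \<epsilon> \<open>\<epsilon> < pi / 2\<close> by auto
  ultimately show thesis using that by blast
qed


section \<open>Translation to the origin and the jump formula on \<open>[a, b]\<close>\<close>

theorem theorem4:
  fixes a b \<tau> r :: real
    and f g g_o :: "real \<Rightarrow> complex"
    and z :: "nat \<Rightarrow> complex"
  assumes "a < \<tau>" and "\<tau> < b"
    and "set_integrable lebesgue {a..b} f"
    and "\<And>x. x \<in> {a - \<tau>..b - \<tau>} \<Longrightarrow> g x = f (x + \<tau>)"
    and "r = min (\<tau> - a) (b - \<tau>)"
    and "\<And>t. t \<in> {-r..r} \<Longrightarrow> g_o t = 1 / 2 * (g t - g (- t))"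
    and "set_integrable lebesgue {-r..r} (\<lambda>t. g_o t / of_real t)"
    and "continuous (at \<tau> within {a..b}) f"
    and "(\<forall>n. z n \<in> upper_half_plane) \<or> (\<forall>n. z n \<in> lower_half_plane)"
    and "converges_nontangentially z \<tau>"
  shows "pv_exists f a b \<tau> \<and>
    ((\<forall>n. z n \<in> upper_half_plane) \<longrightarrow>
       (\<lambda>n. cauchy_integral f a b (z n)) \<longlonglongrightarrow>
         1 / 2 * f \<tau> + 1 / (2 * of_real pi * \<i>) * pv_integral f a b \<tau>) \<and>
    ((\<forall>n. z n \<in> lower_half_plane) \<longrightarrow>
       (\<lambda>n. cauchy_integral f a b (z n)) \<longlonglongrightarrow>
         - (1 / 2) * f \<tau> + 1 / (2 * of_real pi * \<i>) * pv_integral f a b \<tau>)"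
proof -
  define F where "F t = indicator {a..b} t *\<^sub>R f t" for t
  define h where "h t = F (\<tau> + t)" for t
  define q where "q t = (h t - h (-t)) / 2 / of_real t" for t
  define L where "L = integral\<^sup>L lebesgue q"
  have F: "integrable lebesgue F" using assms(3) by (simp add: F_def[abs_def] set_integrable_def)
  have h: "integrable lebesgue h"
    unfolding h_def using lebesgue_integrable_real_affine[OF F, of 1 \<tau>] by simp
  have h': "integrable lebesgue (\<lambda>t. h (-t))"
    using lebesgue_integrable_real_affine[OF h, of "-1" 0] by simp
  have r: "r > 0" "r \<le> \<tau> - a" "r \<le> b - \<tau>" using assms(1,2,5) by auto
  \<comment> \<open>On \<open>{-r..r}\<close> this is the hypothesis on \<open>g_o\<close>; outside,
    \<open>1 / |t|\<close> is at most \<open>1 / r\<close> and the odd part of \<open>h\<close> is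
    integrable.\<close>
  have q: "integrable lebesgue q"
  proof -
    have "integrable lebesgue (\<lambda>t. indicator {-r..r} t *\<^sub>R (g_o t / of_real t))"
      using assms(7) by (simp add: set_integrable_def)
    moreover have "integrable lebesgue (\<lambda>t. (h t - h (-t)) / 2 * (indicator (- {-r..r}) t / of_real t))"
    proof (rule integrable_mult_bounded)
      show "(\<lambda>t. indicator (- {-r..r}) t / complex_of_real t) \<in> borel_measurable lebesgue"
        by (rule measurable_completion) simp
      show "norm (indicator (- {-r..r}) t / complex_of_real t) \<le> 1 / r" for t
      proof (cases "t \<in> {-r..r}")
        case False
        then have "r \<le> \<bar>t\<bar>" by auto
        then show ?thesis using r(1) by (simp add: indicator_def norm_divide frac_le)
      qed (use r in simp)
    qed (use h h' in auto)
    ultimately have "integrable lebesgue (\<lambda>t. indicator {-r..r} t *\<^sub>R (g_o t / of_real t) +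
       (h t - h (-t)) / 2 * (indicator (- {-r..r}) t / of_real t))"
      by (rule Bochner_Integration.integrable_add)
    also have "(\<lambda>t. indicator {-r..r} t *\<^sub>R (g_o t / of_real t) +
       (h t - h (-t)) / 2 * (indicator (- {-r..r}) t / of_real t)) = q"
    proof
      fix t
      show "indicator {-r..r} t *\<^sub>R (g_o t / of_real t) +
         (h t - h (-t)) / 2 * (indicator (- {-r..r}) t / of_real t) = q t"
      proof (cases "t \<in> {-r..r}")
        case True
        then have "g t = h t" "g (-t) = h (-t)"
          using r assms(4)[of t] assms(4)[of "-t"] by (auto simp: h_def F_def add.commute)
        with True show ?thesis by (simp add: q_def assms(6))
      qed (simp add: q_def)
    qed
    finally show ?thesis .
  qed
  \<comment> \<open>Since \<open>\<tau>\<close> is interior, continuity within \<open>{a..b}\<close>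
    is full continuity, and the zero extension agrees with \<open>f\<close> near
    \<open>\<tau>\<close>.\<close>
  have cont: "isCont h 0"
  proof -
    have "isCont f \<tau>"
      using assms(1,2,8) by (metis at_within_Icc_at)
    moreover have "\<forall>\<^sub>F t in nhds \<tau>. F t = f t"
      using eventually_nhds_in_open[of "{a<..<b}" \<tau>] assms(1,2)
      by (auto simp: F_def elim!: eventually_mono)
    ultimately have "isCont F (\<tau> + 0)" by (simp add: isCont_cong)
    then show ?thesis
      unfolding h_def using isCont_o2[of 0 "\<lambda>t. \<tau> + t" F] by (simp add: continuous_add)
  qed
  have h0: "h 0 = f \<tau>" using assms(1,2) by (simp add: h_def F_def)

  have trunc_int: "integrable lebesgue (\<lambda>t. F t * (indicator A t / of_real (t - \<tau>)))"
    if "\<delta> > 0" "A \<in> sets borel" "\<And>t. t \<in> A \<Longrightarrow> \<delta> \<le> \<bar>t - \<tau>\<bar>" for \<delta> and A :: "real set"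
  proof (rule integrable_mult_bounded[OF F])
    show "(\<lambda>t. indicator A t / complex_of_real (t - \<tau>)) \<in> borel_measurable lebesgue"
      using that(2) by (intro measurable_completion) simp
    show "norm (indicator A t / complex_of_real (t - \<tau>)) \<le> 1 / \<delta>" for t
      using that(1,3) by (auto simp: indicator_def norm_divide frac_le simp flip: of_real_diff)
  qed
  have pieces: "indicator {a..\<tau> - \<delta>} t *\<^sub>R (f t / of_real (t - \<tau>)) = F t * (indicator {a..\<tau> - \<delta>} t / of_real (t - \<tau>))"
    "indicator {\<tau> + \<delta>..b} t *\<^sub>R (f t / of_real (t - \<tau>)) = F t * (indicator {\<tau> + \<delta>..b} t / of_real (t - \<tau>))"
    if "\<delta> > 0" for t \<delta>
    using assms(1,2) that by (auto simp: F_def indicator_def)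
  have trunc_integrable: "set_integrable lebesgue {a..\<tau> - \<delta>} (\<lambda>t. f t / of_real (t - \<tau>))"
    "set_integrable lebesgue {\<tau> + \<delta>..b} (\<lambda>t. f t / of_real (t - \<tau>))" if "\<delta> > 0" for \<delta>
    unfolding set_integrable_def pieces[OF that] by (rule trunc_int[OF that]; auto)+
  have trunc: "truncated_pv_integral f a b \<tau> \<delta> = (LINT t|lebesgue. h t * (indicator {t. \<delta> \<le> \<bar>t\<bar>} t / of_real t))"
    if "\<delta> > 0" for \<delta>
  proof -
    have "truncated_pv_integral f a b \<tau> \<delta> =
        (LINT t|lebesgue. indicator {a..\<tau> - \<delta>} t *\<^sub>R (f t / of_real (t - \<tau>)) + indicator {\<tau> + \<delta>..b} t *\<^sub>R (f t / of_real (t - \<tau>)))"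
      unfolding truncated_pv_integral_def set_lebesgue_integral_def
      using trunc_integrable[OF that] by (intro Bochner_Integration.integral_add[symmetric]) (auto simp: set_integrable_def)
    \<comment> \<open>For \<open>\<delta> > 0\<close> the two intervals are disjoint and form the
      part of \<open>{a..b}\<close> at distance at least \<open>\<delta>\<close> from
      \<open>\<tau>\<close>; \<open>F\<close> vanishes outside \<open>{a..b}\<close>.\<close>
    also have "\<dots> = (LINT t|lebesgue. F t * (indicator {t. \<delta> \<le> \<bar>t - \<tau>\<bar>} t / of_real (t - \<tau>)))"
      using that assms(1,2) by (intro Bochner_Integration.integral_cong refl) (auto simp: F_def indicator_def)
    also have "\<dots> = (LINT t|lebesgue. h t * (indicator {t. \<delta> \<le> \<bar>t\<bar>} t / of_real t))"
      by (subst lebesgue_integral_real_affine[of 1 _ \<tau>]) (auto simp: h_def indicator_def)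
    finally show ?thesis .
  qed
  have lim: "(truncated_pv_integral f a b \<tau> \<longlongrightarrow> L) (at_right 0)"
    by (rule Lim_transform_eventually[OF tendsto_truncated_integral_odd_part[OF h q[unfolded q_def], folded q_def L_def]])
       (use eventually_at_right_less[of 0] in \<open>auto elim!: eventually_mono simp: trunc\<close>)
  have "pv_exists f a b \<tau>"
    unfolding pv_exists_def using lim trunc_integrable eventually_at_right_less[of "0::real"]
    by (auto elim!: eventually_mono)
  moreover have pv: "pv_integral f a b \<tau> = L"
    unfolding pv_integral_def using lim by (intro tendsto_Lim) auto

  obtain k where k: "0 \<le> k" "k < 1" "\<And>n. \<bar>Re (z n - of_real \<tau>)\<bar> \<le> k * norm (z n - of_real \<tau>)"
    using converges_nontangentially_cone[OF assms(10)] by blast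
  have z: "(\<lambda>n. z n - of_real \<tau>) \<longlonglongrightarrow> 0"
    using assms(10) by (simp add: converges_nontangentially_def LIM_zero)
  have "cauchy_integral f a b w = 1 / (2 * of_real pi * \<i>) * (LINT t|lebesgue. h t / (of_real t - (w - of_real \<tau>)))" for w
  proof -
    have "(LINT t:{a..b}|lebesgue. f t / (of_real t - w)) = (LINT t|lebesgue. F t / (of_real t - w))"
      unfolding set_lebesgue_integral_def by (intro Bochner_Integration.integral_cong) (auto simp: F_def indicator_def)
    also have "\<dots> = (LINT t|lebesgue. h t / (of_real t - (w - of_real \<tau>)))"
      by (subst lebesgue_integral_real_affine[of 1 _ \<tau>]) (auto simp: h_def algebra_simps)
    finally show ?thesis by (simp add: cauchy_integral_def)
  qed
  then have main: "(\<lambda>n. cauchy_integral f a b (z n)) \<longlonglongrightarrow> \<sigma> * (1 / 2) * f \<tau> + 1 / (2 * of_real pi * \<i>) * L"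
    if "\<And>n. \<sigma> * Im (z n) > 0" "\<sigma> = 1 \<or> \<sigma> = -1" for \<sigma> :: real
  proof -
    have "(\<lambda>n. LINT t|lebesgue. h t / (of_real t - (z n - of_real \<tau>))) \<longlonglongrightarrow> \<sigma> * (\<i> * pi * f \<tau>) + L"
      using LIMSEQ_integral_cauchy_kernel[OF h q[unfolded q_def] cont _ z that(2) k(3,1,2), folded q_def L_def] that(1)
      by (simp add: h0)
    then have "(\<lambda>n. cauchy_integral f a b (z n)) \<longlonglongrightarrow> 1 / (2 * of_real pi * \<i>) * (\<sigma> * (\<i> * pi * f \<tau>) + L)"
      unfolding \<open>\<And>w. cauchy_integral f a b w = _\<close> by (intro tendsto_mult_left)
    \<comment> \<open>The prefactor turns the mass \<open>\<i> * pi\<close> into the coefficient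
      \<open>1 / 2\<close> of the jump term.\<close>
    also have "1 / (2 * of_real pi * \<i>) * (\<sigma> * (\<i> * pi * f \<tau>) + L) = \<sigma> * (1 / 2) * f \<tau> + 1 / (2 * of_real pi * \<i>) * L"
      by (simp add: distrib_left)
    finally show ?thesis .
  qed
  ultimately show ?thesis
    unfolding pv using main[of 1] main[of "-1"]
    by (auto simp: upper_half_plane_def lower_half_plane_def)
qed

end
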